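(* Let $1<p<\infty$. The Banach space $\ell_p^{\lambda}(\widehat F)$ has Banach–Saks type $p$.
   Context: $\mathbb N_0=\{0,1,2,\dots\}$; $\omega$ is the space of all real sequences $x=(x_k)_{k\in\mathbb N_0}$. Fibonacci numbers: $f_0=f_1=1$, $f_n=f_{n-1}+f_{n-2}$ for $n\ge 2$. $\lambda=(\lambda_k)_{k\in\mathbb N_0}$ is a fixed strictly increasing sequence of positive reals with $\lambda_k\to\infty$. Terms with negative subscript are $0$ (so $\lambda_{-1}=0$, $x_{-1}=0$). For $x\in\omega$ put $$E_n(x)=\frac1{\lambda_n}\sum_{k=0}^n(\lambda_k-\lambda_{k-1})\Big(\frac{f_k}{f_{k+1}}x_k-\frac{f_{k+1}}{f_k}x_{k-1}\Big),\qquad Ex=(E_n(x))_{n\in\mathbb N_0},$$ and $\ell_p^{\lambda}(\widehat F)=\{x\in\omega: Ex\in\ell_p\}$ with norm $\|x\|=\|Ex\|_p$. A Banach space has Banach–Saks type $p$ (for $1<p<\infty$) if every weakly null sequence $(x_k)$ has a subsequence $(x_{k_l})_{l\in\mathbb N_0}$ such that, for some $C>0$, $\big\|\sum_{l=0}^nx_{k_l}\big\|<C(n+1)^{1/p}$ for all $n\in\mathbb N_0$. *)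

theory Defs
  imports "HOL-Analysis.Analysis" "HOL-Number_Theory.Fib"
begin

section \<open>Banach spaces of real sequences and Banach--Saks type\<close>

text \<open>
  A normed space of real sequences is given by a set V of sequences, with the pointwise
  operations, and a norm function N of which only the values on V are relevant.
\<close>

definition seq_normed_space :: "(nat \<Rightarrow> real) set \<Rightarrow> ((nat \<Rightarrow> real) \<Rightarrow> real) \<Rightarrow> bool" where
  "seq_normed_space V N \<longleftrightarrow>
     (\<lambda>k. 0) \<in> V \<and>
     (\<forall>x\<in>V. \<forall>y\<in>V. (\<lambda>k. x k + y k) \<in> V) \<and>
     (\<forall>c. \<forall>x\<in>V. (\<lambda>k. c * x k) \<in> V) \<and>
     (\<forall>x\<in>V. 0 \<le> N x) \<and>
     (\<forall>x\<in>V. N x = 0 \<longleftrightarrow> x = (\<lambda>k. 0)) \<and>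
     (\<forall>c. \<forall>x\<in>V. N (\<lambda>k. c * x k) = \<bar>c\<bar> * N x) \<and>
     (\<forall>x\<in>V. \<forall>y\<in>V. N (\<lambda>k. x k + y k) \<le> N x + N y)"

definition seq_banach_space :: "(nat \<Rightarrow> real) set \<Rightarrow> ((nat \<Rightarrow> real) \<Rightarrow> real) \<Rightarrow> bool" where
  "seq_banach_space V N \<longleftrightarrow>
     seq_normed_space V N \<and> Metric_space.mcomplete V (\<lambda>x y. N (\<lambda>k. x k - y k))"

definition seq_dual ::
    "(nat \<Rightarrow> real) set \<Rightarrow> ((nat \<Rightarrow> real) \<Rightarrow> real) \<Rightarrow> ((nat \<Rightarrow> real) \<Rightarrow> real) set" where
  "seq_dual V N =
     {\<phi>. (\<forall>x\<in>V. \<forall>y\<in>V. \<phi> (\<lambda>k. x k + y k) = \<phi> x + \<phi> y) \<and>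
         (\<forall>c. \<forall>x\<in>V. \<phi> (\<lambda>k. c * x k) = c * \<phi> x) \<and>
         (\<exists>B. \<forall>x\<in>V. \<bar>\<phi> x\<bar> \<le> B * N x)}"

definition seq_weakly_null ::
    "(nat \<Rightarrow> real) set \<Rightarrow> ((nat \<Rightarrow> real) \<Rightarrow> real) \<Rightarrow> (nat \<Rightarrow> nat \<Rightarrow> real) \<Rightarrow> bool" where
  "seq_weakly_null V N X \<longleftrightarrow>
     range X \<subseteq> V \<and> (\<forall>\<phi>\<in>seq_dual V N. (\<lambda>n. \<phi> (X n)) \<longlonglongrightarrow> 0)"

definition banach_saks_type ::
    "real \<Rightarrow> (nat \<Rightarrow> real) set \<Rightarrow> ((nat \<Rightarrow> real) \<Rightarrow> real) \<Rightarrow> bool" where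
  "banach_saks_type p V N \<longleftrightarrow>
     (\<forall>X. seq_weakly_null V N X \<longrightarrow>
        (\<exists>r :: nat \<Rightarrow> nat. strict_mono r \<and>
          (\<exists>C>0. \<forall>n. N (\<lambda>j. \<Sum>l\<le>n. X (r l) j) < C * (real n + 1) powr (1 / p))))"


section \<open>The spaces $\ell_p$ and $\ell_p^\lambda(\widehat F)$\<close>

definition ell :: "real \<Rightarrow> (nat \<Rightarrow> real) set" where
  "ell p = {x. summable (\<lambda>k. \<bar>x k\<bar> powr p)}"

definition ell_norm :: "real \<Rightarrow> (nat \<Rightarrow> real) \<Rightarrow> real" where
  "ell_norm p x = (\<Sum>k. \<bar>x k\<bar> powr p) powr (1 / p)"

text \<open>
  The Fibonacci numbers are indexed so that the values at 0 and 1 are both 1, whereas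
  the library has fib 0 = 0 and fib 1 = 1.
\<close>

definition fibo :: "nat \<Rightarrow> real" where
  "fibo n = real (fib (Suc n))"

text \<open>The term of index k - 1, with terms of negative index equal to 0.\<close>

definition prev :: "(nat \<Rightarrow> real) \<Rightarrow> nat \<Rightarrow> real" where
  "prev x k = (if k = 0 then 0 else x (k - 1))"

definition E_lam :: "(nat \<Rightarrow> real) \<Rightarrow> (nat \<Rightarrow> real) \<Rightarrow> nat \<Rightarrow> real" where
  "E_lam lam x n =
     1 / lam n * (\<Sum>k\<le>n. (lam k - prev lam k) *
        (fibo k / fibo (k + 1) * x k - fibo (k + 1) / fibo k * prev x k))"

definition ell_lam_F :: "(nat \<Rightarrow> real) \<Rightarrow> real \<Rightarrow> (nat \<Rightarrow> real) set" where
  "ell_lam_F lam p = {x. E_lam lam x \<in> ell p}"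

definition ell_lam_F_norm :: "(nat \<Rightarrow> real) \<Rightarrow> real \<Rightarrow> (nat \<Rightarrow> real) \<Rightarrow> real" where
  "ell_lam_F_norm lam p x = ell_norm p (E_lam lam x)"

end

theory Submission
  imports Defs
begin

text \<open>
  The operator E is a linear bijection on the space of all sequences, since the defining relation
  determines x successively. Hence the weighted space is isometric to \<open>\<ell>\<^sub>p\<close>, and both claims
  reduce to \<open>\<ell>\<^sub>p\<close>. There, a weakly null sequence is bounded and converges to zero in each
  coordinate; a gliding hump argument yields a subsequence that agrees with a sequence of
  disjointly supported bounded vectors up to errors of norm \<open>2\<^bsup>-l\<^esup>\<close>. The p-th powers of the
  norms of disjointly supported vectors add up, which gives the growth rate \<open>(n + 1)\<^bsup>1/p\<^esup>\<close>.
\<close>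

section \<open>Minkowski's inequality and completeness of \<open>ell p\<close>\<close>

text \<open>Convexity of the p-th power at \<open>a / s\<close> and \<open>b / t\<close>: with
  weights \<open>s / (s + t)\<close> and \<open>t / (s + t)\<close> the convex combination of these
  points is \<open>(a + b) / (s + t)\<close>.\<close>

lemma powr_add_le_weighted:
  fixes a b s t p :: real
  assumes "1 \<le> p" "0 \<le> a" "0 \<le> b" "0 < s" "0 < t"
  shows "(a + b) powr p
           \<le> (s + t) powr p * (s / (s + t) * (a / s) powr p + t / (s + t) * (b / t) powr p)"
proof -
  define u where "u = s / (s + t)"
  have u: "0 < u" "u < 1" and u1: "1 - u = t / (s + t)"
    using assms by (auto simp: u_def field_simps)
  have shrink: "(v * c) powr p \<le> v * c powr p" if "0 < v" "v < 1" for v c :: real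
  proof -
    have "v powr p \<le> v powr 1"
      using that assms by (intro powr_mono') auto
    then have "v powr p * c powr p \<le> v * c powr p"
      using that by (intro mult_right_mono) auto
    then show ?thesis
      by (simp add: powr_mult)
  qed
  have "(u * (a / s) + (1 - u) * (b / t)) powr p
          \<le> u * (a / s) powr p + (1 - u) * (b / t) powr p"
  \<comment> \<open>Convexity is applied only at two positive points. If one point is zero, a single
    summand remains on the left and \<open>shrink\<close> bounds it.\<close>
  proof (cases "a = 0 \<or> b = 0")
    case True
    then show ?thesis
      using shrink[of u "a / s"] shrink[of "1 - u" "b / t"] u by auto
  next
    case False
    then have "0 < a / s" "0 < b / t"
      using assms by auto
    then show ?thesis
      using convex_onD[OF powr_convex[OF assms(1)], of "1 - u" "a / s" "b / t"] u by simp
  qed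
  moreover have "u * (a / s) = a / (s + t)" "(1 - u) * (b / t) = b / (s + t)"
    using assms unfolding u1 by (simp_all add: u_def)
  ultimately have "(a + b) powr p / (s + t) powr p
      \<le> u * (a / s) powr p + (1 - u) * (b / t) powr p"
    using assms by (simp add: powr_divide flip: add_divide_distrib)
  then show ?thesis
    using assms unfolding u1 u_def by (simp add: field_simps)
qed

lemma ell_norm_nonneg [simp]: "0 \<le> ell_norm p x"
  by (simp add: ell_norm_def)

lemma sum_powr_le_ell_norm:
  assumes "0 < p" "x \<in> ell p" "finite A"
  shows "(\<Sum>k\<in>A. \<bar>x k\<bar> powr p) \<le> ell_norm p x powr p"
proof -
  have s: "summable (\<lambda>k. \<bar>x k\<bar> powr p)"
    using assms by (simp add: ell_def)
  have "(\<Sum>k\<in>A. \<bar>x k\<bar> powr p) \<le> (\<Sum>k. \<bar>x k\<bar> powr p)"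
    by (intro sum_le_suminf s assms) auto
  also have "\<dots> = ell_norm p x powr p"
    using assms s by (simp add: ell_norm_def powr_powr suminf_nonneg)
  finally show ?thesis .
qed

lemma suminf_powr_eq_ell_norm:
  assumes "0 < p" "x \<in> ell p"
  shows "(\<Sum>k. \<bar>x k\<bar> powr p) = ell_norm p x powr p"
  using assms by (simp add: ell_norm_def ell_def powr_powr suminf_nonneg)

text \<open>Lets membership and a norm bound be checked together on finite partial sums; the
  triangle inequality, completeness and the estimates for windows and disjoint supports all go
  through it.\<close>

lemma ell_norm_leI:
  assumes "0 < p" "0 \<le> c" and le: "\<And>n. (\<Sum>k<n. \<bar>x k\<bar> powr p) \<le> c powr p"
  shows "x \<in> ell p" "ell_norm p x \<le> c"
proof -
  have s: "summable (\<lambda>k. \<bar>x k\<bar> powr p)"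
    by (rule summableI_nonneg_bounded[OF _ le]) simp
  then show "x \<in> ell p"
    by (simp add: ell_def)
  have "(\<Sum>k. \<bar>x k\<bar> powr p) \<le> c powr p"
    by (rule suminf_le_const[OF s le])
  then have "ell_norm p x \<le> (c powr p) powr (1 / p)"
    unfolding ell_norm_def using assms s by (intro powr_mono2 suminf_nonneg) auto
  then show "ell_norm p x \<le> c"
    using assms by (simp add: powr_powr)
qed

lemma abs_le_ell_norm:
  assumes "0 < p" "x \<in> ell p"
  shows "\<bar>x k\<bar> \<le> ell_norm p x"
proof -
  have "\<bar>x k\<bar> powr p \<le> ell_norm p x powr p"
    using sum_powr_le_ell_norm[OF assms, of "{k}"] by simp
  then show ?thesis
    using powr_less_mono2[OF assms(1) ell_norm_nonneg, of p x "\<bar>x k\<bar>"] by linarith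
qed

lemma ell_norm_scale:
  assumes "0 < p" "x \<in> ell p"
  shows "(\<lambda>k. c * x k) \<in> ell p" "ell_norm p (\<lambda>k. c * x k) = \<bar>c\<bar> * ell_norm p x"
proof -
  have eq: "(\<lambda>k. \<bar>c * x k\<bar> powr p) = (\<lambda>k. \<bar>c\<bar> powr p * \<bar>x k\<bar> powr p)"
    by (simp add: abs_mult powr_mult)
  show "(\<lambda>k. c * x k) \<in> ell p"
    using assms by (simp add: ell_def eq summable_mult)
  show "ell_norm p (\<lambda>k. c * x k) = \<bar>c\<bar> * ell_norm p x"
    using assms unfolding ell_norm_def eq
    by (simp add: ell_def suminf_mult powr_mult powr_powr)
qed

text \<open>
  Minkowski's inequality without duality: for s and t slightly above the two norms, convexity
  is applied to x / s and y / t with weights s / (s + t) and t / (s + t). The slack keeps s and t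
  positive.
\<close>

lemma ell_norm_add:
  assumes p: "1 \<le> p" and x: "x \<in> ell p" and y: "y \<in> ell p"
  shows "(\<lambda>k. x k + y k) \<in> ell p"
    and "ell_norm p (\<lambda>k. x k + y k) \<le> ell_norm p x + ell_norm p y"
proof -
  have *: "(\<lambda>k. x k + y k) \<in> ell p \<and>
      ell_norm p (\<lambda>k. x k + y k) \<le> (ell_norm p x + e) + (ell_norm p y + e)" if "0 < e" for e
  proof -
    define s t where "s = ell_norm p x + e" and "t = ell_norm p y + e"
    have st: "0 < s" "0 < t"
      using that by (auto simp: s_def t_def intro: add_nonneg_pos)
    have unit: "(\<Sum>k<n. (\<bar>z k\<bar> / r) powr p) \<le> 1"
      if "z \<in> ell p" "ell_norm p z \<le> r" "0 < r" for z n r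
    proof -
      have "(\<Sum>k<n. \<bar>z k\<bar> powr p) \<le> ell_norm p z powr p"
        using p that by (intro sum_powr_le_ell_norm) auto
      also have "\<dots> \<le> r powr p"
        using p that by (intro powr_mono2) auto
      finally show ?thesis
        using that by (simp add: powr_divide flip: sum_divide_distrib)
    qed
    have lin: "(\<Sum>k<n. c * (u * f k + v * g k)) = c * (u * (\<Sum>k<n. f k) + v * (\<Sum>k<n. g k))"
      for c u v :: real and f g :: "nat \<Rightarrow> real" and n
      by (simp add: sum.distrib flip: sum_distrib_left)
    have "(\<Sum>k<n. \<bar>x k + y k\<bar> powr p) \<le> (s + t) powr p" for n
    proof -
      have "(\<Sum>k<n. \<bar>x k + y k\<bar> powr p) \<le> (\<Sum>k<n. (\<bar>x k\<bar> + \<bar>y k\<bar>) powr p)"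
        using p by (intro sum_mono powr_mono2) auto
      also have "\<dots> \<le> (\<Sum>k<n. (s + t) powr p *
          (s / (s + t) * (\<bar>x k\<bar> / s) powr p + t / (s + t) * (\<bar>y k\<bar> / t) powr p))"
        using p st by (intro sum_mono powr_add_le_weighted) auto
      also have "\<dots> = (s + t) powr p * (s / (s + t) * (\<Sum>k<n. (\<bar>x k\<bar> / s) powr p)
          + t / (s + t) * (\<Sum>k<n. (\<bar>y k\<bar> / t) powr p))"
        by (rule lin)
      also have "\<dots> \<le> (s + t) powr p * (s / (s + t) * 1 + t / (s + t) * 1)"
        using st that unit[OF x, of s n] unit[OF y, of t n]
        by (intro mult_left_mono add_mono) (auto simp: s_def t_def)
      also have "\<dots> = (s + t) powr p"
        using st by (simp flip: add_divide_distrib)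
      finally show ?thesis .
    qed
    then show ?thesis
      using ell_norm_leI[of p "s + t" "\<lambda>k. x k + y k"] p st by (simp add: s_def t_def)
  qed
  show "(\<lambda>k. x k + y k) \<in> ell p"
    using *[of 1] by simp
  show "ell_norm p (\<lambda>k. x k + y k) \<le> ell_norm p x + ell_norm p y"
  proof (rule field_le_epsilon)
    fix e :: real
    assume "0 < e"
    then show "ell_norm p (\<lambda>k. x k + y k) \<le> ell_norm p x + ell_norm p y + e"
      using *[of "e / 2"] by simp
  qed
qed

lemma ell_norm_diff:
  assumes "1 \<le> p" "x \<in> ell p" "y \<in> ell p"
  shows "(\<lambda>k. x k - y k) \<in> ell p"
    and "ell_norm p (\<lambda>k. x k - y k) \<le> ell_norm p x + ell_norm p y"
  using ell_norm_add[OF assms(1,2) ell_norm_scale(1)[OF _ assms(3), of "-1"]]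
    ell_norm_scale(2)[OF _ assms(3), of "-1"] assms(1) by auto

lemma zero_in_ell [simp]: "(\<lambda>k. 0) \<in> ell p" "ell_norm p (\<lambda>k. 0) = 0"
  by (simp_all add: ell_def ell_norm_def)

lemma ell_norm_eq_0_iff:
  assumes "0 < p" "x \<in> ell p"
  shows "ell_norm p x = 0 \<longleftrightarrow> x = (\<lambda>k. 0)"
proof
  assume "ell_norm p x = 0"
  then show "x = (\<lambda>k. 0)"
    using abs_le_ell_norm[OF assms] by (auto simp: fun_eq_iff)
qed simp

lemma seq_normed_space_ell:
  assumes "1 \<le> p"
  shows "seq_normed_space (ell p) (ell_norm p)"
  unfolding seq_normed_space_def
  using assms by (simp add: ell_norm_add ell_norm_scale ell_norm_eq_0_iff)

text \<open>Coordinates are dominated by the norm, so a Cauchy sequence has a coordinatewise limit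
  \<open>z\<close>. The Cauchy estimate survives the limit on every finite partial sum and therefore
  for the whole norm.\<close>

lemma ell_complete:
  fixes y :: "nat \<Rightarrow> nat \<Rightarrow> real"
  assumes p: "1 \<le> p" and y: "\<And>n. y n \<in> ell p"
    and cauchy: "\<And>e. 0 < e \<Longrightarrow> \<exists>N. \<forall>m\<ge>N. \<forall>n\<ge>N. ell_norm p (\<lambda>k. y m k - y n k) < e"
  obtains z where "z \<in> ell p"
    and "\<And>e. 0 < e \<Longrightarrow> \<exists>N. \<forall>n\<ge>N. ell_norm p (\<lambda>k. y n k - z k) < e"
proof -
  have "\<exists>l. (\<lambda>n. y n k) \<longlonglongrightarrow> l" for k
  proof -
    have "Cauchy (\<lambda>n. y n k)"
      unfolding Cauchy_def dist_real_def
    proof (intro allI impI)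
      fix e :: real
      assume "0 < e"
      then obtain N where N: "\<And>m n. m \<ge> N \<Longrightarrow> n \<ge> N \<Longrightarrow> ell_norm p (\<lambda>k. y m k - y n k) < e"
        using cauchy by blast
      have "\<bar>y m k - y n k\<bar> < e" if "m \<ge> N" "n \<ge> N" for m n
        using abs_le_ell_norm[OF _ ell_norm_diff(1)[OF p y[of m] y[of n]], of k] N[OF that] p by simp
      then show "\<exists>N. \<forall>m\<ge>N. \<forall>n\<ge>N. \<bar>y m k - y n k\<bar> < e"
        by blast
    qed
    then show ?thesis
      by (simp add: Cauchy_convergent convergent_def[symmetric])
  qed
  then obtain z where z: "\<And>k. (\<lambda>n. y n k) \<longlonglongrightarrow> z k"
    by metis
  have *: "\<exists>N. \<forall>n\<ge>N. (\<lambda>k. y n k - z k) \<in> ell p \<and> ell_norm p (\<lambda>k. y n k - z k) \<le> e"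
    if e: "0 < e" for e
  proof -
    obtain N where N: "\<And>m n. m \<ge> N \<Longrightarrow> n \<ge> N \<Longrightarrow> ell_norm p (\<lambda>k. y m k - y n k) < e"
      using cauchy[OF e] by blast
    \<comment> \<open>With \<open>n\<close> and \<open>K\<close> fixed, \<open>m\<close> tends to
      infinity in a finite sum, so coordinatewise convergence suffices.\<close>
    have "(\<Sum>k<K. \<bar>y n k - z k\<bar> powr p) \<le> e powr p" if n: "n \<ge> N" for n K
    proof (rule tendsto_upperbound)
      show "(\<lambda>m. \<Sum>k<K. \<bar>y n k - y m k\<bar> powr p) \<longlonglongrightarrow> (\<Sum>k<K. \<bar>y n k - z k\<bar> powr p)"
        using p by (intro tendsto_intros z tendsto_powr') auto
      have "(\<Sum>k<K. \<bar>y n k - y m k\<bar> powr p) \<le> e powr p" if "m \<ge> N" for m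
      proof -
        have "(\<Sum>k<K. \<bar>y n k - y m k\<bar> powr p) \<le> ell_norm p (\<lambda>k. y n k - y m k) powr p"
          using p by (intro sum_powr_le_ell_norm ell_norm_diff y) auto
        also have "\<dots> \<le> e powr p"
          using p N[OF n that] by (intro powr_mono2) auto
        finally show ?thesis .
      qed
      then show "\<forall>\<^sub>F m in sequentially. (\<Sum>k<K. \<bar>y n k - y m k\<bar> powr p) \<le> e powr p"
        by (auto simp: eventually_sequentially)
    qed simp
    then show ?thesis
      using p e ell_norm_leI[of p e "\<lambda>k. y n k - z k" for n] by (intro exI[of _ N]) auto
  qed
  obtain n where "(\<lambda>k. y n k - z k) \<in> ell p"
    using *[of 1] by auto
  from ell_norm_diff(1)[OF p y[of n] this] have "z \<in> ell p"
    by simp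
  moreover have "\<exists>N. \<forall>n\<ge>N. ell_norm p (\<lambda>k. y n k - z k) < e" if e: "0 < e" for e
    \<comment> \<open>Passing to the limit left only a weak inequality; halving \<open>e\<close>
      restores the strict one.\<close>
    using *[of "e / 2"] e by (metis field_sum_of_halves half_gt_zero less_add_same_cancel1 order.strict_trans1)
  ultimately show ?thesis
    by (rule that)
qed

section \<open>Norming functionals and uniform boundedness\<close>

text \<open>Supplies the functionals for \<open>weakly_null_bounded\<close> with
  \<open>K = 2\<close>. The value at \<open>z\<close> is exact, whereas the bound on the other
  vectors may lose a constant factor there.\<close>

lemma ell_norming_functional:
  assumes p: "1 \<le> p" and z: "z \<in> ell p"
  shows "\<exists>\<phi>\<in>seq_dual (ell p) (ell_norm p).
           \<phi> z = ell_norm p z \<and> (\<forall>y\<in>ell p. \<bar>\<phi> y\<bar> \<le> 2 * ell_norm p y)"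
proof (cases "z = (\<lambda>k. 0)")
  case True
  then show ?thesis
    by (intro bexI[of _ "\<lambda>y. 0"]) (auto simp: seq_dual_def intro: exI[of _ 0])
next
  case False
  define N where "N = ell_norm p z"
  have N: "0 < N"
    using ell_norm_eq_0_iff[OF _ z] ell_norm_nonneg[of p z] False p unfolding N_def by linarith
  \<comment> \<open>These weights give equality in Hoelder's inequality against \<open>z\<close>:
    the products \<open>w k * z k\<close> are nonnegative and sum to \<open>N\<close>.\<close>
  define w where "w k = sgn (z k) * (\<bar>z k\<bar> / N) powr (p - 1)" for k
  define \<phi> where "\<phi> y = (\<Sum>k. w k * y k)" for y
  have bound: "summable (\<lambda>k. w k * y k) \<and> \<bar>\<phi> y\<bar> \<le> 2 * ell_norm p y" if y: "y \<in> ell p" for y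
  proof (cases "y = (\<lambda>k. 0)")
    case True
    then show ?thesis
      by (simp add: \<phi>_def)
  next
    case False
    define M where "M = ell_norm p y"
    have M: "0 < M"
      using ell_norm_eq_0_iff[OF _ y] ell_norm_nonneg[of p y] False p unfolding M_def by linarith
    define g where "g k = M * ((\<bar>z k\<bar> / N) powr p + (\<bar>y k\<bar> / M) powr p)" for k
    \<comment> \<open>This crude form of Young's inequality replaces Hoelder's inequality and costs the factor 2.\<close>
    have le: "\<bar>w k * y k\<bar> \<le> g k" for k
    proof -
      define a b where "a = \<bar>z k\<bar> / N" and "b = \<bar>y k\<bar> / M"
      have ab: "0 \<le> a" "0 \<le> b"
        using M N by (auto simp: a_def b_def)
      have "a powr (p - 1) * b \<le> max a b powr (p - 1) * max a b"
        using p ab by (intro mult_mono powr_mono2) auto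
      also have "\<dots> = max a b powr p"
        using ab powr_mult_base[of "max a b" "p - 1"] by (simp add: mult.commute max_def split: if_splits)
      also have "\<dots> \<le> a powr p + b powr p"
        by (simp add: max_def)
      finally have "M * (a powr (p - 1) * b) \<le> g k"
        unfolding g_def a_def b_def by (rule mult_left_mono) (use M in simp)
      moreover have "\<bar>w k * y k\<bar> \<le> M * (a powr (p - 1) * b)"
        using M by (simp add: w_def a_def b_def abs_mult abs_sgn_eq)
      ultimately show ?thesis
        by linarith
    qed
    have "(\<lambda>k. (\<bar>x k\<bar> / r) powr p) sums 1" if "x \<in> ell p" "r = ell_norm p x" "0 < r" for x r
    proof -
      have "(\<lambda>k. \<bar>x k\<bar> powr p) sums r powr p"
        using that p by (metis ell_def mem_Collect_eq less_le_trans zero_less_one suminf_powr_eq_ell_norm summable_sums)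
      from sums_divide[OF this, of "r powr p"] show ?thesis
        using that by (simp add: powr_divide)
    qed
    from sums_mult[OF sums_add[OF this[OF z N_def N] this[OF y M_def M]], of M]
    have g: "g sums (2 * M)"
      by (simp add: g_def[abs_def] mult.commute)
    have s: "summable (\<lambda>k. \<bar>w k * y k\<bar>)"
      by (rule summable_comparison_test[OF _ sums_summable[OF g]]) (use le in auto)
    have "\<bar>\<phi> y\<bar> \<le> (\<Sum>k. \<bar>w k * y k\<bar>)"
      unfolding \<phi>_def by (rule summable_rabs[OF s])
    also have "\<dots> \<le> 2 * M"
      using suminf_le[OF le s sums_summable[OF g]] sums_unique[OF g] by simp
    finally show ?thesis
      using summable_rabs_cancel[OF s] by (simp add: M_def)
  qed
  have "\<phi> \<in> seq_dual (ell p) (ell_norm p)"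
    unfolding seq_dual_def
  proof (intro CollectI conjI ballI allI exI[of _ 2])
    fix x y c
    assume "x \<in> ell p"
    then show "\<bar>\<phi> x\<bar> \<le> 2 * ell_norm p x" "\<phi> (\<lambda>k. c * x k) = c * \<phi> x"
      using bound[of x] suminf_mult[of "\<lambda>k. w k * x k" c] by (auto simp: \<phi>_def ac_simps)
    assume "y \<in> ell p"
    with \<open>x \<in> ell p\<close> show "\<phi> (\<lambda>k. x k + y k) = \<phi> x + \<phi> y"
      using bound[of x] bound[of y] by (simp add: \<phi>_def distrib_left suminf_add)
  qed
  moreover have "\<phi> z = N"
  proof -
    have "w k * z k = \<bar>z k\<bar> powr p * inverse (N powr (p - 1))" for k
    proof -
      have "w k * z k = \<bar>z k\<bar> * (\<bar>z k\<bar> / N) powr (p - 1)"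
        by (simp add: w_def abs_sgn)
      then show ?thesis
        using powr_mult_base[of "\<bar>z k\<bar>" "p - 1"] by (simp add: powr_divide flip: divide_inverse)
    qed
    then have "\<phi> z = N powr p * inverse (N powr (p - 1))"
      using z p suminf_powr_eq_ell_norm[OF _ z]
      by (simp add: \<phi>_def N_def ell_def suminf_mult2[symmetric])
    also have "\<dots> = N"
      using N by (simp add: powr_diff)
    finally show ?thesis .
  qed
  ultimately show ?thesis
    using bound unfolding N_def by blast
qed

text \<open>The signs are fixed one after another: \<open>s j\<close> makes the new term of column
  \<open>j\<close> agree in sign with the sum of the earlier terms of that column, so nothing
  cancels.\<close>

lemma sign_choice:
  fixes a :: "nat \<Rightarrow> nat \<Rightarrow> real"
  obtains s :: "nat \<Rightarrow> real"
  where "\<And>j. \<bar>s j\<bar> = 1" "\<And>j. \<bar>a j j\<bar> \<le> \<bar>\<Sum>i<Suc j. s i * a i j\<bar>"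
proof -
  have "\<exists>s. \<forall>j. \<bar>s j\<bar> = 1 \<and> \<bar>a j j\<bar> \<le> \<bar>(\<Sum>i<j. s i * a i j) + s j * a j j\<bar>"
  proof (rule dependent_wf_choice[OF wf_less_than])
    fix s :: "nat \<Rightarrow> real" and j
    show "\<exists>r. \<bar>r\<bar> = 1 \<and> \<bar>a j j\<bar> \<le> \<bar>(\<Sum>i<j. s i * a i j) + r * a j j\<bar>"
    proof (cases "0 \<le> (\<Sum>i<j. s i * a i j) * a j j")
      case True
      then show ?thesis
        by (intro exI[of _ 1]) (auto simp: zero_le_mult_iff)
    next
      case False
      then show ?thesis
        by (intro exI[of _ "-1"]) (auto simp: zero_le_mult_iff)
    qed
  next
    \<comment> \<open>The condition on the choice at \<open>x\<close> depends only on the values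
      below \<open>x\<close>, as well-founded choice requires.\<close>
    fix f g :: "nat \<Rightarrow> real" and x r
    assume "\<And>z. (z, x) \<in> less_than \<Longrightarrow> f z = g z"
    then have "(\<Sum>i<x. f i * a i x) = (\<Sum>i<x. g i * a i x)"
      by (intro sum.cong) auto
    then show "(\<bar>r\<bar> = 1 \<and> \<bar>a x x\<bar> \<le> \<bar>(\<Sum>i<x. f i * a i x) + r * a x x\<bar>) =
       (\<bar>r\<bar> = 1 \<and> \<bar>a x x\<bar> \<le> \<bar>(\<Sum>i<x. g i * a i x) + r * a x x\<bar>)"
      by simp
  qed
  then show ?thesis
    using that by auto
qed

text \<open>
  Uniform boundedness without Baire category: along a subsequence with norms growing fast enough,
  norming functionals are summed with geometric weights. The signs prevent cancellation in the
  partial sums, and the ratio q is chosen so that the tail of the series is at most half of the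
  leading contribution.
\<close>

lemma weakly_null_bounded:
  assumes space: "seq_normed_space V N"
    and norming: "\<And>x. x \<in> V \<Longrightarrow> \<exists>\<phi>\<in>seq_dual V N. \<phi> x = N x \<and> (\<forall>y\<in>V. \<bar>\<phi> y\<bar> \<le> K * N y)"
    and K: "0 < K" and null: "seq_weakly_null V N X"
  shows "\<exists>B. \<forall>n. N (X n) \<le> B"
proof (rule ccontr)
  assume unbounded: "\<not> ?thesis"
  define q where "q = 1 / (2 * K + 1)"
  have q: "0 < q" "q < 1" and Kq: "K * (q / (1 - q)) = 1 / 2"
    using K by (auto simp: q_def field_simps)
  \<comment> \<open>The size is such that half of the leading contribution
    \<open>q ^ j * N (X n)\<close>, the part left after subtracting the tail, still exceeds
    \<open>j\<close>.\<close>
  have "\<exists>n. 2 * real j / q ^ j < N (X n)" for j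
    using unbounded by (auto simp: not_le)
  then obtain n where n: "\<And>j. 2 * real j / q ^ j < N (X (n j))"
    by metis
  define Y where "Y j = X (n j)" for j
  have Y: "Y j \<in> V" for j
    using null by (auto simp: seq_weakly_null_def Y_def)
  have large: "real j < q ^ j * N (Y j) / 2" for j
    using n[of j] q by (simp add: Y_def field_simps)
  obtain \<phi> where dual: "\<And>j. \<phi> j \<in> seq_dual V N" and norm: "\<And>j. \<phi> j (Y j) = N (Y j)"
    and le: "\<And>j y. y \<in> V \<Longrightarrow> \<bar>\<phi> j y\<bar> \<le> K * N y"
    using norming[OF Y] by metis
  obtain s where s: "\<And>j. \<bar>s j\<bar> = 1"
    and part: "\<And>j. \<bar>q ^ j * \<phi> j (Y j)\<bar> \<le> \<bar>\<Sum>i<Suc j. s i * (q ^ i * \<phi> i (Y j))\<bar>"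
    using sign_choice[of "\<lambda>i j. q ^ i * \<phi> i (Y j)"] by blast
  define t where "t y i = s i * (q ^ i * \<phi> i y)" for y i
  define \<Phi> where "\<Phi> y = (\<Sum>i. t y i)" for y
  have t_le: "\<bar>t y i\<bar> \<le> K * N y * q ^ i" if "y \<in> V" for y i
    using mult_left_mono[OF le[OF that, of i], of "q ^ i"] q s
    by (simp add: t_def abs_mult mult.commute)
  have geo: "summable (\<lambda>i. c * q ^ i)" for c
    using q by (intro summable_mult summable_geometric) auto
  have sum_t: "summable (t y)" if "y \<in> V" for y
    by (rule summable_comparison_test[OF _ geo[of "K * N y"]]) (use t_le[OF that] in auto)
  \<comment> \<open>Used twice: \<open>m = 0\<close> shows that \<open>\<Phi>\<close> is bounded,
    and \<open>m = Suc j\<close> cuts off everything after the leading term for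
    \<open>Y j\<close>.\<close>
  have tail: "\<bar>\<Phi> y - (\<Sum>i<m. t y i)\<bar> \<le> K * N y * q ^ m / (1 - q)" if y: "y \<in> V" for y m
  proof -
    have "\<bar>\<Phi> y - (\<Sum>i<m. t y i)\<bar> = \<bar>\<Sum>i. t y (i + m)\<bar>"
      using suminf_split_initial_segment[OF sum_t[OF y], of m] by (simp add: \<Phi>_def)
    also have "\<dots> \<le> (\<Sum>i. K * N y * q ^ m * q ^ i)"
    proof (rule norm_suminf_le[where 'a = real, simplified])
      fix i
      show "\<bar>t y (i + m)\<bar> \<le> K * N y * q ^ m * q ^ i"
        using t_le[OF y, of "i + m"] by (simp add: power_add ac_simps)
    qed (rule geo)
    also have "\<dots> = K * N y * q ^ m / (1 - q)"
      using q by (simp add: suminf_mult summable_geometric suminf_geometric)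
    finally show ?thesis .
  qed
  have "\<Phi> \<in> seq_dual V N"
    unfolding seq_dual_def
  proof (intro CollectI conjI ballI allI exI[of _ "K / (1 - q)"])
    fix x y c
    assume x: "x \<in> V"
    then show "\<bar>\<Phi> x\<bar> \<le> K / (1 - q) * N x"
      using tail[of x 0] by simp
    have "t (\<lambda>k. c * x k) = (\<lambda>i. c * t x i)"
      using dual x by (auto simp: t_def seq_dual_def)
    then show "\<Phi> (\<lambda>k. c * x k) = c * \<Phi> x"
      using sum_t[OF x] by (simp add: \<Phi>_def suminf_mult)
    assume y: "y \<in> V"
    have "t (\<lambda>k. x k + y k) = (\<lambda>i. t x i + t y i)"
      using dual x y by (auto simp: t_def seq_dual_def algebra_simps)
    then show "\<Phi> (\<lambda>k. x k + y k) = \<Phi> x + \<Phi> y"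
      using sum_t[OF x] sum_t[OF y] by (simp add: \<Phi>_def suminf_add)
  qed
  then have "(\<lambda>i. \<Phi> (X i)) \<longlonglongrightarrow> 0"
    using null by (simp add: seq_weakly_null_def)
  then have "Bseq (\<lambda>i. \<Phi> (X i))"
    by (intro convergent_imp_Bseq convergentI)
  then obtain B where B: "\<And>i. \<bar>\<Phi> (X i)\<bar> \<le> B"
    by (auto simp: Bseq_def)
  obtain j where j: "B < real j"
    using reals_Archimedean2 by blast
  \<comment> \<open>The initial segment has at least this size and the tail at most half of it, so
    \<open>\<Phi> (Y j)\<close> exceeds \<open>j\<close>, and hence \<open>B\<close>, in absolute
    value.\<close>
  have "q ^ j * N (Y j) \<le> \<bar>\<Sum>i<Suc j. t (Y j) i\<bar>"
    using part[of j] by (simp add: t_def norm)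
  moreover have "\<bar>\<Phi> (Y j) - (\<Sum>i<Suc j. t (Y j) i)\<bar> \<le> q ^ j * N (Y j) / 2"
  proof -
    have "K * N (Y j) * q ^ Suc j / (1 - q) = K * (q / (1 - q)) * (q ^ j * N (Y j))"
      by simp
    also have "\<dots> = q ^ j * N (Y j) / 2"
      unfolding Kq by simp
    finally have eq: "K * N (Y j) * q ^ Suc j / (1 - q) = q ^ j * N (Y j) / 2" .
    show ?thesis
      using tail[OF Y, of j "Suc j"] unfolding eq .
  qed
  ultimately show False
    using large[of j] B[of "n j"] j unfolding Y_def by linarith
qed

section \<open>Disjoint supports, the gliding hump and the growth rate in
  \<open>ell p\<close>\<close>

lemma ell_norm_sum_le:
  assumes p: "1 \<le> p" and A: "finite A" and x: "\<And>l. l \<in> A \<Longrightarrow> x l \<in> ell p"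
  shows "(\<lambda>k. \<Sum>l\<in>A. x l k) \<in> ell p \<and>
    ell_norm p (\<lambda>k. \<Sum>l\<in>A. x l k) \<le> (\<Sum>l\<in>A. ell_norm p (x l))"
  using A x
proof (induction A rule: finite_induct)
  case (insert a A)
  then show ?case
    using ell_norm_add[OF p, of "x a" "\<lambda>k. \<Sum>l\<in>A. x l k"] by fastforce
qed simp

text \<open>At most one summand is nonzero, so the sum reduces to a single term.\<close>

lemma abs_sum_powr_disjoint_le:
  fixes u :: "'a \<Rightarrow> real"
  assumes "finite A" and disj: "\<And>l m. l \<in> A \<Longrightarrow> m \<in> A \<Longrightarrow> l \<noteq> m \<Longrightarrow> u l = 0 \<or> u m = 0"
  shows "\<bar>\<Sum>l\<in>A. u l\<bar> powr p \<le> (\<Sum>l\<in>A. \<bar>u l\<bar> powr p)"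
proof (cases "\<exists>l\<in>A. u l \<noteq> 0")
  case True
  then obtain l where l: "l \<in> A" "u l \<noteq> 0"
    by blast
  then have "(\<Sum>m\<in>A. u m) = (\<Sum>m\<in>{l}. u m)"
    using assms by (intro sum.mono_neutral_right) auto
  then show ?thesis
    using member_le_sum[of l A "\<lambda>m. \<bar>u m\<bar> powr p"] l assms by simp
qed (simp add: sum_nonneg)

text \<open>In each coordinate the p-th power passes inside the sum. Interchanging the two sums
  leaves \<open>card A\<close> norms, each contributing at most \<open>M powr p\<close>.\<close>

lemma ell_norm_sum_disjoint_le:
  assumes p: "1 \<le> p" and A: "finite A" and x: "\<And>l. l \<in> A \<Longrightarrow> x l \<in> ell p"
    and le: "\<And>l. l \<in> A \<Longrightarrow> ell_norm p (x l) \<le> M" and M: "0 \<le> M"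
    and disj: "\<And>l m k. l \<in> A \<Longrightarrow> m \<in> A \<Longrightarrow> l \<noteq> m \<Longrightarrow> x l k = 0 \<or> x m k = 0"
  shows "ell_norm p (\<lambda>k. \<Sum>l\<in>A. x l k) \<le> M * real (card A) powr (1 / p)"
proof (rule ell_norm_leI(2))
  fix n
  have "(\<Sum>k<n. \<bar>\<Sum>l\<in>A. x l k\<bar> powr p) \<le> (\<Sum>k<n. \<Sum>l\<in>A. \<bar>x l k\<bar> powr p)"
    by (intro sum_mono abs_sum_powr_disjoint_le A disj)
  also have "\<dots> = (\<Sum>l\<in>A. \<Sum>k<n. \<bar>x l k\<bar> powr p)"
    by (rule sum.swap)
  also have "\<dots> \<le> (\<Sum>l\<in>A. M powr p)"
  proof (rule sum_mono)
    fix l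
    assume l: "l \<in> A"
    have "(\<Sum>k<n. \<bar>x l k\<bar> powr p) \<le> ell_norm p (x l) powr p"
      using p x[OF l] by (intro sum_powr_le_ell_norm) auto
    also have "\<dots> \<le> M powr p"
      using p le[OF l] by (intro powr_mono2) auto
    finally show "(\<Sum>k<n. \<bar>x l k\<bar> powr p) \<le> M powr p" .
  qed
  also have "\<dots> = (M * real (card A) powr (1 / p)) powr p"
    using p by (simp add: powr_mult powr_powr)
  finally show "(\<Sum>k<n. \<bar>\<Sum>l\<in>A. x l k\<bar> powr p) \<le> (M * real (card A) powr (1 / p)) powr p" .
qed (use p M in auto)

text \<open>The interval is half-open, so that windows between consecutive cut points are
  disjoint.\<close>

definition window :: "nat \<Rightarrow> nat \<Rightarrow> (nat \<Rightarrow> real) \<Rightarrow> nat \<Rightarrow> real" where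
  "window a b x k = (if a \<le> k \<and> k < b then x k else 0)"

lemma ell_norm_window:
  assumes "0 < p" "x \<in> ell p"
  shows "window a b x \<in> ell p" "ell_norm p (window a b x) \<le> ell_norm p x"
proof -
  have "(\<Sum>k<n. \<bar>window a b x k\<bar> powr p) \<le> ell_norm p x powr p" for n
  proof -
    have "(\<Sum>k<n. \<bar>window a b x k\<bar> powr p) \<le> (\<Sum>k<n. \<bar>x k\<bar> powr p)"
      by (intro sum_mono) (simp add: window_def)
    also have "\<dots> \<le> ell_norm p x powr p"
      using assms by (intro sum_powr_le_ell_norm) auto
    finally show ?thesis .
  qed
  from ell_norm_leI[OF assms(1) ell_norm_nonneg this]
  show "window a b x \<in> ell p" "ell_norm p (window a b x) \<le> ell_norm p x"
    by auto
qed

text \<open>One step of the gliding hump. The finitely many coordinates below \<open>a\<close>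
  become small for late \<open>n\<close>; once \<open>n\<close> is fixed, summability makes the tail
  beyond some \<open>b\<close> small. Head and tail each receive half of
  \<open>e powr p\<close>.\<close>

lemma ell_window_approx:
  assumes p: "1 \<le> p" and Y: "\<And>n. Y n \<in> ell p"
    and null: "\<And>k. (\<lambda>n. Y n k) \<longlonglongrightarrow> 0" and e: "0 < e"
  shows "\<exists>n>m. \<exists>b\<ge>a. ell_norm p (\<lambda>k. Y n k - window a b (Y n) k) \<le> e"
proof -
  define d where "d = e powr p / 2"
  have d: "0 < d"
    using e by (simp add: d_def)
  have "(\<lambda>n. \<Sum>k<a. \<bar>Y n k\<bar> powr p) \<longlonglongrightarrow> (\<Sum>k<a. \<bar>0\<bar> powr p)"
    using p by (intro tendsto_intros null tendsto_powr') auto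
  then have "\<forall>\<^sub>F n in sequentially. (\<Sum>k<a. \<bar>Y n k\<bar> powr p) < d"
    using d by (intro order_tendstoD(2)[of _ 0]) auto
  from eventually_conj[OF this eventually_gt_at_top[of m]]
  obtain n where n: "m < n" and head: "(\<Sum>k<a. \<bar>Y n k\<bar> powr p) < d"
    by (auto dest: eventually_happens)
  have "summable (\<lambda>k. \<bar>Y n k\<bar> powr p)"
    using Y[of n] by (simp add: ell_def)
  then obtain b' where "\<forall>b\<ge>b'. \<forall>j. norm (\<Sum>k\<in>{b..<j}. \<bar>Y n k\<bar> powr p) < d"
    using d unfolding summable_Cauchy by blast
  then have b': "(\<Sum>k\<in>{b..<j}. \<bar>Y n k\<bar> powr p) < d" if "b' \<le> b" for b j
    using that by (metis abs_ge_self le_less_trans real_norm_def)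
  \<comment> \<open>The maximum keeps the head and tail index sets disjoint and gives
    \<open>a \<le> b\<close>.\<close>
  define b where "b = max a b'"
  define z where "z k = Y n k - window a b (Y n) k" for k
  have "(\<Sum>k<j. \<bar>z k\<bar> powr p) \<le> e powr p" for j
  proof -
    have "(\<Sum>k<j. \<bar>z k\<bar> powr p) = (\<Sum>k\<in>{..<j} - {a..<b}. \<bar>Y n k\<bar> powr p)"
      by (rule sum.mono_neutral_cong_right) (auto simp: z_def window_def)
    also have "\<dots> \<le> (\<Sum>k\<in>{..<a} \<union> {b..<j}. \<bar>Y n k\<bar> powr p)"
      by (intro sum_mono2) auto
    also have "\<dots> = (\<Sum>k<a. \<bar>Y n k\<bar> powr p) + (\<Sum>k\<in>{b..<j}. \<bar>Y n k\<bar> powr p)"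
      by (rule sum.union_disjoint) (auto simp: b_def)
    also have "\<dots> \<le> d + d"
      using head b'[of b j] by (simp add: b_def)
    finally show ?thesis
      by (simp add: d_def)
  qed
  then have "ell_norm p z \<le> e"
    using p e by (intro ell_norm_leI(2)) auto
  then show ?thesis
    using n unfolding z_def b_def by (intro exI[of _ n] conjI exI[of _ "max a b'"]) auto
qed

text \<open>Iterates \<open>ell_window_approx\<close>, starting each window where the previous one
  ended and choosing each index beyond the previous one.\<close>

lemma ell_gliding_hump:
  assumes p: "1 \<le> p" and Y: "\<And>n. Y n \<in> ell p"
    and null: "\<And>k. (\<lambda>n. Y n k) \<longlonglongrightarrow> 0" and e: "\<And>l. 0 < e l"
  obtains r c :: "nat \<Rightarrow> nat" where "strict_mono r" "mono c"
    and "\<And>l. ell_norm p (\<lambda>k. Y (r l) k - window (c l) (c (Suc l)) (Y (r l)) k) \<le> e l"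
proof -
  \<comment> \<open>A state is a pair of the last chosen index and the end of its window.\<close>
  define Q where "Q l s t \<longleftrightarrow> fst s < fst t \<and> snd s \<le> snd t \<and>
      ell_norm p (\<lambda>k. Y (fst t) k - window (snd s) (snd t) (Y (fst t)) k) \<le> e l"
    for l and s t :: "nat \<times> nat"
  have "\<exists>f. \<forall>l. True \<and> Q l (f l) (f (Suc l))"
  proof (rule dependent_nat_choice)
    fix s l
    show "\<exists>t. True \<and> Q l s t"
      using ell_window_approx[OF p Y null e, of "fst s" "snd s" l] by (auto simp: Q_def)
  qed simp
  then obtain f where f: "\<And>l. Q l (f l) (f (Suc l))"
    by blast
  show ?thesis
  proof
    \<comment> \<open>The vector chosen in step \<open>l\<close> is recorded in state
      \<open>Suc l\<close>, and its window runs between the ends stored in states \<open>l\<close>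
      and \<open>Suc l\<close>; hence only the indices are shifted.\<close>
    show "strict_mono (\<lambda>l. fst (f (Suc l)))" "mono (\<lambda>l. snd (f l))"
      using f by (auto simp: Q_def strict_mono_Suc_iff mono_iff_le_Suc)
    show "ell_norm p (\<lambda>k. Y (fst (f (Suc l))) k -
        window (snd (f l)) (snd (f (Suc l))) (Y (fst (f (Suc l)))) k) \<le> e l" for l
      using f[of l] by (simp add: Q_def)
  qed
qed

text \<open>Turns weak convergence to zero into convergence in each coordinate.\<close>

lemma ell_coordinate_in_dual:
  assumes "0 < p"
  shows "(\<lambda>x. x k) \<in> seq_dual (ell p) (ell_norm p)"
  using abs_le_ell_norm[OF assms] by (auto simp: seq_dual_def intro!: exI[of _ 1])

theorem banach_saks_type_ell:
  assumes p: "1 \<le> p"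
  shows "banach_saks_type p (ell p) (ell_norm p)"
  unfolding banach_saks_type_def
proof (intro allI impI)
  fix Y
  assume null: "seq_weakly_null (ell p) (ell_norm p) Y"
  have Y: "Y n \<in> ell p" for n
    using null by (auto simp: seq_weakly_null_def)
  obtain M where M: "\<And>n. ell_norm p (Y n) \<le> M"
    using weakly_null_bounded[OF seq_normed_space_ell[OF p] ell_norming_functional[OF p] _ null]
    by auto
  have "0 \<le> M"
    using M[of 0] ell_norm_nonneg[of p "Y 0"] by linarith
  have coord: "(\<lambda>n. Y n k) \<longlonglongrightarrow> 0" for k
    using null ell_coordinate_in_dual[of p k] p by (auto simp: seq_weakly_null_def)
  obtain r c :: "nat \<Rightarrow> nat" where r: "strict_mono r" and c: "mono c"
    and small: "\<And>l. ell_norm p (\<lambda>k. Y (r l) k - window (c l) (c (Suc l)) (Y (r l)) k) \<le> (1 / 2) ^ l"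
    using ell_gliding_hump[OF p Y coord, of "\<lambda>l. (1 / 2) ^ l"] by auto
  define b where "b l = window (c l) (c (Suc l)) (Y (r l))" for l
  define d where "d l k = Y (r l) k - b l k" for l k
  have b: "b l \<in> ell p" "ell_norm p (b l) \<le> M" for l
    using ell_norm_window(1)[OF _ Y] order_trans[OF ell_norm_window(2)[OF _ Y] M] p
    by (simp_all add: b_def)
  have d: "d l \<in> ell p" "ell_norm p (d l) \<le> (1 / 2) ^ l" for l
    using ell_norm_diff(1)[OF p Y b(1)] small[of l] by (auto simp: d_def[abs_def] b_def)
  have disj: "b l k = 0 \<or> b m k = 0" if "l \<noteq> m" for l m k
    using that
  proof (induction l m rule: linorder_wlog)
    case (le l m)
    \<comment> \<open>The earlier window ends no later than the other one starts.\<close>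
    then have "c (Suc l) \<le> c m"
      by (intro monoD[OF c]) auto
    then show ?case
      by (auto simp: b_def window_def)
  qed auto
  \<comment> \<open>\<open>M\<close> accounts for the humps \<open>b l\<close>. The errors
    \<open>d l\<close> have total norm below 2, which is strictly less than 3 times a factor that is
    at least 1; this also yields the strict inequality.\<close>
  have "ell_norm p (\<lambda>k. \<Sum>l\<le>n. Y (r l) k) < (M + 3) * (real n + 1) powr (1 / p)" for n
  proof -
    have sum_b: "(\<lambda>k. \<Sum>l\<le>n. b l k) \<in> ell p"
      and sum_d: "(\<lambda>k. \<Sum>l\<le>n. d l k) \<in> ell p"
      and norm_d: "ell_norm p (\<lambda>k. \<Sum>l\<le>n. d l k) \<le> (\<Sum>l\<le>n. ell_norm p (d l))"
      using ell_norm_sum_le[OF p, of "{..n}"] b d by auto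
    have "ell_norm p (\<lambda>k. \<Sum>l\<le>n. Y (r l) k)
        \<le> ell_norm p (\<lambda>k. \<Sum>l\<le>n. b l k) + ell_norm p (\<lambda>k. \<Sum>l\<le>n. d l k)"
      using ell_norm_add(2)[OF p sum_b sum_d] by (simp add: d_def flip: sum.distrib)
    also have "ell_norm p (\<lambda>k. \<Sum>l\<le>n. b l k) \<le> M * real (card {..n}) powr (1 / p)"
      using b disj \<open>0 \<le> M\<close> by (intro ell_norm_sum_disjoint_le p) auto
    also note norm_d
    also have "(\<Sum>l\<le>n. ell_norm p (d l)) \<le> (\<Sum>l\<le>n. (1 / 2) ^ l)"
      by (intro sum_mono d)
    also have "(\<Sum>l\<le>n. (1 / 2) ^ l) = 2 - (1 / 2 :: real) ^ n"
      by (induction n) auto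
    also have "2 - (1 / 2) ^ n < 3 * (real n + 1) powr (1 / p)"
    proof -
      have "1 \<le> (real n + 1) powr (1 / p)"
        using p by (intro ge_one_powr_ge_zero) auto
      moreover have "0 < (1 / 2 :: real) ^ n"
        by simp
      ultimately show ?thesis
        by linarith
    qed
    finally show ?thesis
      by (simp add: algebra_simps)
  qed
  then show "\<exists>r. strict_mono r \<and> (\<exists>C>0. \<forall>n.
      ell_norm p (\<lambda>k. \<Sum>l\<le>n. Y (r l) k) < C * (real n + 1) powr (1 / p))"
    using r \<open>0 \<le> M\<close> by (intro exI[of _ r] conjI exI[of _ "M + 3"]) auto
qed

section \<open>The operator \<open>E_lam\<close> and transfer to the weighted space\<close>

lemma prev_linear [simp]:
  "prev (\<lambda>k. x k + y k) n = prev x n + prev y n"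
  "prev (\<lambda>k. c * x k) n = c * prev x n"
  by (simp_all add: prev_def)

lemma E_lam_linear:
  shows E_lam_add: "E_lam lam (\<lambda>k. x k + y k) = (\<lambda>n. E_lam lam x n + E_lam lam y n)"
    and E_lam_scale: "E_lam lam (\<lambda>k. c * x k) = (\<lambda>n. c * E_lam lam x n)"
proof -
  define a b where "a k = (lam k - prev lam k) * (fibo k / fibo (k + 1))"
    and "b k = (lam k - prev lam k) * (fibo (k + 1) / fibo k)" for k
  have E: "E_lam lam x n = 1 / lam n * (\<Sum>k\<le>n. a k * x k - b k * prev x k)" for x n
    unfolding E_lam_def a_def b_def by (simp only: right_diff_distrib mult.assoc)
  show "E_lam lam (\<lambda>k. x k + y k) = (\<lambda>n. E_lam lam x n + E_lam lam y n)"
    and "E_lam lam (\<lambda>k. c * x k) = (\<lambda>n. c * E_lam lam x n)"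
    by (simp_all add: fun_eq_iff E sum.distrib sum_subtractf sum_distrib_left algebra_simps
        add_divide_distrib diff_divide_distrib)
qed

lemma E_lam_zero: "E_lam lam (\<lambda>k. 0) = (\<lambda>n. 0)"
  using E_lam_scale[of lam 0] by simp

lemma E_lam_diff: "E_lam lam (\<lambda>k. x k - y k) = (\<lambda>n. E_lam lam x n - E_lam lam y n)"
  using E_lam_add[of lam x "\<lambda>k. -1 * y k"] E_lam_scale[of lam "-1" y] by simp

lemma E_lam_sum:
  "finite A \<Longrightarrow> E_lam lam (\<lambda>k. \<Sum>l\<in>A. x l k) = (\<lambda>n. \<Sum>l\<in>A. E_lam lam (x l) n)"
  by (induction A rule: finite_induct) (simp_all add: E_lam_zero E_lam_add)

text \<open>Partial summation and backward difference are mutually inverse; the convention that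
  \<open>prev h 0\<close> is 0 covers the first term.\<close>

lemma sum_atMost_eq_iff_prev:
  fixes g h :: "nat \<Rightarrow> real"
  shows "(\<forall>n. (\<Sum>k\<le>n. g k) = h n) \<longleftrightarrow> (\<forall>n. g n = h n - prev h n)"
proof
  assume sum: "\<forall>n. (\<Sum>k\<le>n. g k) = h n"
  show "\<forall>n. g n = h n - prev h n"
  proof
    fix n
    show "g n = h n - prev h n"
      using sum[rule_format, of n] sum[rule_format, of "n - 1"] by (cases n) (auto simp: prev_def)
  qed
next
  assume g: "\<forall>n. g n = h n - prev h n"
  have "(\<Sum>k\<le>n. g k) = h n" for n
    using g by (induction n) (auto simp: prev_def)
  then show "\<forall>n. (\<Sum>k\<le>n. g k) = h n"
    by blast
qed

lemma ex1_prev_recurrence: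
  fixes h :: "nat \<Rightarrow> real \<Rightarrow> real"
  shows "\<exists>!x. \<forall>n. x n = h n (prev x n)"
proof
  \<comment> \<open>The initial value is \<open>h 0 0\<close> because \<open>prev x 0\<close> is 0
    for every \<open>x\<close>.\<close>
  define x where "x = rec_nat (h 0 0) (\<lambda>n. h (Suc n))"
  show "\<forall>n. x n = h n (prev x n)"
  proof
    fix n
    show "x n = h n (prev x n)"
      by (cases n) (auto simp: x_def prev_def)
  qed
  fix y
  assume y: "\<forall>n. y n = h n (prev y n)"
  show "y = x"
  proof
    fix n
    show "y n = x n"
    proof (induction n)
      case 0
      then show ?case
        using y[rule_format, of 0] by (simp add: x_def prev_def)
    next
      case (Suc n)
      then show ?case
        using y[rule_format, of "Suc n"] by (simp add: x_def prev_def)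
    qed
  qed
qed

lemma fibo_pos: "0 < fibo n"
  by (simp add: fibo_def fib_neq_0_nat)

text \<open>Multiplying by \<open>lam n\<close> and taking differences turns the equation into a
  first-order recurrence. It can be solved for \<open>x n\<close>, since the increments of
  \<open>lam\<close> and the Fibonacci quotients are positive.\<close>

lemma ex1_E_lam_eq:
  assumes mono: "strict_mono lam" and pos: "\<And>k. 0 < lam k"
  shows "\<exists>!x. E_lam lam x = y"
proof -
  define w where "w n = lam n - prev lam n" for n
  have w: "0 < w n" for n
    using pos strict_monoD[OF mono] by (simp add: w_def prev_def)
  define h where "h n = lam n * y n" for n
  have "E_lam lam x = y \<longleftrightarrow>
    (\<forall>n. x n = fibo (n + 1) / fibo n *
        ((h n - prev h n) / w n + fibo (n + 1) / fibo n * prev x n))" for x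
  proof -
    define g where "g n = w n * (fibo n / fibo (n + 1) * x n - fibo (n + 1) / fibo n * prev x n)"
      for n
    have "E_lam lam x = y \<longleftrightarrow> (\<forall>n. (\<Sum>k\<le>n. g k) = h n)"
    proof -
      have "E_lam lam x n = (\<Sum>k\<le>n. g k) / lam n" for n
        by (simp add: E_lam_def g_def w_def)
      moreover have "lam n \<noteq> 0" for n
        using pos[of n] by simp
      ultimately show ?thesis
        by (simp add: fun_eq_iff h_def nonzero_divide_eq_eq mult.commute)
    qed
    also have "\<dots> \<longleftrightarrow> (\<forall>n. g n = h n - prev h n)"
      by (rule sum_atMost_eq_iff_prev)
    also have "\<dots> \<longleftrightarrow> (\<forall>n. x n = fibo (n + 1) / fibo n *
        ((h n - prev h n) / w n + fibo (n + 1) / fibo n * prev x n))"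
    proof (rule arg_cong[where f = All], rule ext)
      fix n
      have solve: "a * (r * u - v) = t \<longleftrightarrow> u = 1 / r * (t / a + v)"
        if "0 < a" "0 < r" for a r u v t :: real
        using that by (auto simp: field_simps)
      show "g n = h n - prev h n \<longleftrightarrow> x n = fibo (n + 1) / fibo n *
        ((h n - prev h n) / w n + fibo (n + 1) / fibo n * prev x n)"
        using solve[OF w[of n], of "fibo n / fibo (n + 1)"] fibo_pos by (simp add: g_def)
    qed
    finally show ?thesis .
  qed
  then show ?thesis
    using ex1_prev_recurrence[of "\<lambda>n u. fibo (n + 1) / fibo n *
        ((h n - prev h n) / w n + fibo (n + 1) / fibo n * u)"] by simp
qed

text \<open>All properties are pulled back along the linear map \<open>E_lam lam\<close>;
  definiteness of the norm uses its injectivity.\<close>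

lemma seq_normed_space_ell_lam_F:
  assumes lam: "strict_mono lam" "\<And>k. 0 < lam k" and p: "1 \<le> p"
  shows "seq_normed_space (ell_lam_F lam p) (ell_lam_F_norm lam p)"
proof -
  have "x = (\<lambda>k. 0)" if "E_lam lam x = (\<lambda>k. 0)" for x
    using ex1_E_lam_eq[OF lam] that E_lam_zero by blast
  then show ?thesis
    unfolding seq_normed_space_def ell_lam_F_def ell_lam_F_norm_def
    using p by (auto simp: E_lam_add E_lam_scale E_lam_zero ell_norm_add ell_norm_scale
        ell_norm_eq_0_iff)
qed

text \<open>The map \<open>E_lam lam\<close> preserves distances, so it sends Cauchy sequences to
  Cauchy sequences of \<open>ell p\<close>; surjectivity brings the limit back.\<close>

lemma seq_banach_space_ell_lam_F:
  assumes lam: "strict_mono lam" "\<And>k. 0 < lam k" and p: "1 \<le> p"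
  shows "seq_banach_space (ell_lam_F lam p) (ell_lam_F_norm lam p)"
proof -
  let ?V = "ell_lam_F lam p" and ?N = "ell_lam_F_norm lam p"
  have space: "seq_normed_space ?V ?N"
    by (rule seq_normed_space_ell_lam_F[OF assms])
  define D where "D x y = ?N (\<lambda>k. x k - y k)" for x y
  have D: "D x y = ell_norm p (\<lambda>n. E_lam lam x n - E_lam lam y n)" for x y
    by (simp add: D_def ell_lam_F_norm_def E_lam_diff)
  interpret Metric_space ?V D
  proof
    fix x y z
    show "0 \<le> D x y"
      by (simp add: D)
    show "D x y = D y x"
      by (simp add: D ell_norm_def abs_minus_commute)
    assume "x \<in> ?V" and "y \<in> ?V"
    then have xy: "(\<lambda>k. x k - y k) \<in> ?V" "(\<lambda>n. E_lam lam x n - E_lam lam y n) \<in> ell p"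
      using ell_norm_diff(1)[OF p] by (simp_all add: ell_lam_F_def E_lam_diff)
    then show "D x y = 0 \<longleftrightarrow> x = y"
      using space by (auto simp: seq_normed_space_def D_def fun_eq_iff)
    assume "z \<in> ?V"
    then have yz: "(\<lambda>n. E_lam lam y n - E_lam lam z n) \<in> ell p"
      using \<open>y \<in> ?V\<close> ell_norm_diff(1)[OF p] by (simp add: ell_lam_F_def)
    show "D x z \<le> D x y + D y z"
      using ell_norm_add(2)[OF p xy(2) yz] by (simp add: D)
  qed
  have "mcomplete"
    unfolding mcomplete_def
  proof (intro allI impI)
    fix \<sigma>
    assume cauchy: "MCauchy \<sigma>"
    have \<sigma>: "\<sigma> n \<in> ?V" for n
      using cauchy by (auto simp: MCauchy_def)
    obtain z where z: "z \<in> ell p"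
      and lim: "\<And>e. 0 < e \<Longrightarrow> \<exists>N. \<forall>n\<ge>N. ell_norm p (\<lambda>k. E_lam lam (\<sigma> n) k - z k) < e"
    proof (rule ell_complete[OF p, of "\<lambda>n. E_lam lam (\<sigma> n)"])
      show "E_lam lam (\<sigma> n) \<in> ell p" for n
        using \<sigma> by (simp add: ell_lam_F_def)
      show "\<exists>N. \<forall>m\<ge>N. \<forall>n\<ge>N. ell_norm p (\<lambda>k. E_lam lam (\<sigma> m) k - E_lam lam (\<sigma> n) k) < e"
        if "0 < e" for e
        using cauchy that unfolding MCauchy_def D by meson
    qed (rule that)
    obtain x where "E_lam lam x = z"
      using ex1_E_lam_eq[OF lam] by blast
    then have "limitin mtopology \<sigma> x sequentially"
      using z lim \<sigma> unfolding limitin_metric eventually_sequentially D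
      by (simp add: ell_lam_F_def)
    then show "\<exists>x. limitin mtopology \<sigma> x sequentially"
      by blast
  qed
  then show ?thesis
    using space by (simp add: seq_banach_space_def D_def[abs_def])
qed

text \<open>Composing a bounded functional on \<open>ell p\<close> with \<open>E_lam lam\<close>
  gives a bounded functional on the weighted space.\<close>

lemma seq_weakly_null_E_lam:
  assumes "seq_weakly_null (ell_lam_F lam p) (ell_lam_F_norm lam p) X"
  shows "seq_weakly_null (ell p) (ell_norm p) (\<lambda>n. E_lam lam (X n))"
proof -
  have "(\<lambda>x. \<phi> (E_lam lam x)) \<in> seq_dual (ell_lam_F lam p) (ell_lam_F_norm lam p)"
    if "\<phi> \<in> seq_dual (ell p) (ell_norm p)" for \<phi>
    using that by (auto simp: seq_dual_def ell_lam_F_def ell_lam_F_norm_def E_lam_add E_lam_scale)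
  then show ?thesis
    using assms by (auto simp: seq_weakly_null_def ell_lam_F_def)
qed

theorem theorem5p2:
  fixes lam :: "nat \<Rightarrow> real" and p :: real
  assumes "strict_mono lam"
    and "\<And>k. 0 < lam k"
    and "filterlim lam at_top sequentially"
    and "1 < p"
  shows "seq_banach_space (ell_lam_F lam p) (ell_lam_F_norm lam p) \<and>
    banach_saks_type p (ell_lam_F lam p) (ell_lam_F_norm lam p)"
proof
  have p: "1 \<le> p"
    using assms by simp
  show "seq_banach_space (ell_lam_F lam p) (ell_lam_F_norm lam p)"
    by (rule seq_banach_space_ell_lam_F[OF assms(1,2) p])
  show "banach_saks_type p (ell_lam_F lam p) (ell_lam_F_norm lam p)"
    \<comment> \<open>The subsequence and the constant found for the images serve for
      \<open>X\<close> as well, because \<open>E_lam lam\<close> commutes with finite sums.\<close>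
    using banach_saks_type_ell[OF p] seq_weakly_null_E_lam[of lam p]
    unfolding banach_saks_type_def ell_lam_F_norm_def
    by (simp add: E_lam_sum) blast
qed

end
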